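(* Let $G$ be a graph of order $n\geq2$ with $p$ pendant vertices, $s$ support vertices, and $s'$ strong support vertices. If $V(G)=P(G)\cup S(G)$, then $\alpha_2^{f}(G)=s+s'$. Otherwise, $$\alpha_2^{f}(G)\leq \dfrac{2(n-p)+(s+s')(\delta^{*}+1)}{\delta^{*}+2},$$ where $\delta^*=\delta^*(G)$, and this bound is sharp.
   Context: All graphs are finite and simple. A set $S\subseteq V(G)$ is a $2$-frugal independent set of $G$ if $S$ is independent and every vertex of $G$ has at most $2$ neighbors in $S$; $\alpha_2^f(G)$ is the maximum cardinality of such a set. A pendant vertex is a vertex of degree $1$; a support vertex is a neighbor of a pendant vertex; a support vertex with only one pendant neighbor is a weak support vertex, and otherwise it is a strong support vertex. $P(G)$ and $S(G)$ denote the sets of pendant vertices and of support vertices of $G$. If $P(G)\cup S(G)\subsetneq V(G)$, then $\delta^{*}(G)=\min\{\deg_{G}(v): v \text{ is neither a pendant vertex nor a support vertex of } G\}$.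
   Formalization: The equality for V(G)=P(G)∪S(G) is stated only when no vertex is both pendant and support (no K2 component); it fails otherwise, e.g. for K2, where s+s'=2 but the 2-frugal independence number is 1. *)

theory Defs
  imports Complex_Main "Graph_Theory.Pair_Digraph"
begin

text \<open>
  Finite simple graphs are the symmetric, loopfree, finite pair digraphs of the library
  (locale \<^locale>\<open>pair_graph\<close>): an edge $uv$ is represented by the two arcs $(u,v)$ and $(v,u)$.
\<close>

definition neighbors :: "'a pair_pre_digraph \<Rightarrow> 'a \<Rightarrow> 'a set" where
  "neighbors G v = {u. (v, u) \<in> parcs G}"

definition deg :: "'a pair_pre_digraph \<Rightarrow> 'a \<Rightarrow> nat" where
  "deg G v = card (neighbors G v)"

lemma deg_eq_out_degree: "deg G v = out_degree (with_proj G) v"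
proof -
  have "out_arcs (with_proj G) v = Pair v ` neighbors G v"
    by (auto simp: out_arcs_def neighbors_def)
  then show ?thesis
    by (simp add: deg_def out_degree_def card_image inj_on_def)
qed

definition independent_set :: "'a pair_pre_digraph \<Rightarrow> 'a set \<Rightarrow> bool" where
  "independent_set G I \<longleftrightarrow> I \<subseteq> pverts G \<and> (\<forall>u\<in>I. \<forall>v\<in>I. (u, v) \<notin> parcs G)"

definition frugal_independent_set :: "nat \<Rightarrow> 'a pair_pre_digraph \<Rightarrow> 'a set \<Rightarrow> bool" where
  "frugal_independent_set k G I \<longleftrightarrow>
     independent_set G I \<and> (\<forall>v\<in>pverts G. card (neighbors G v \<inter> I) \<le> k)"

definition frugal_independence_number :: "nat \<Rightarrow> 'a pair_pre_digraph \<Rightarrow> nat" where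
  "frugal_independence_number k G = Max {card I | I. frugal_independent_set k G I}"

definition pendant_vertices :: "'a pair_pre_digraph \<Rightarrow> 'a set" where
  "pendant_vertices G = {v \<in> pverts G. deg G v = 1}"

definition support_vertices :: "'a pair_pre_digraph \<Rightarrow> 'a set" where
  "support_vertices G = {v \<in> pverts G. neighbors G v \<inter> pendant_vertices G \<noteq> {}}"

definition weak_support_vertices :: "'a pair_pre_digraph \<Rightarrow> 'a set" where
  "weak_support_vertices G =
     {v \<in> support_vertices G. card (neighbors G v \<inter> pendant_vertices G) = 1}"

definition strong_support_vertices :: "'a pair_pre_digraph \<Rightarrow> 'a set" where
  "strong_support_vertices G = support_vertices G - weak_support_vertices G"

text \<open>
  Only meaningful if some vertex is neither pendant nor a support vertex (otherwise \<open>Min\<close> is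
  applied to the empty set).
\<close>
definition delta_star :: "'a pair_pre_digraph \<Rightarrow> nat" where
  "delta_star G = Min (deg G ` (pverts G - (pendant_vertices G \<union> support_vertices G)))"

definition frugal_bound :: "'a pair_pre_digraph \<Rightarrow> real" where
  "frugal_bound G =
     (let n = real (card (pverts G));
          p = real (card (pendant_vertices G));
          s = real (card (support_vertices G));
          s' = real (card (strong_support_vertices G));
          d = real (delta_star G)
      in (2 * (n - p) + (s + s') * (d + 1)) / (d + 2))"

end

theory Submission
  imports Defs
begin

text \<open>
  Let $I$ be a $2$-frugal independent set, $P$ the pendant and $S$ the support vertices. Two
  counting arguments carry the upper bounds.

  First, each support vertex $w$ accounts for at most one, or, if $w$ is strong, at most two
  elements of $I$ among $w$ itself and its pendant neighbours: if $w \in I$, then none of these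
  neighbours belongs to $I$; otherwise a weak $w$ has just one of them, and a strong $w$ has at most
  two in $I$ by frugality. As a pendant vertex has exactly one
  neighbour, summing over $S$ gives $|I \cap P| + |I \cap S| \le s + s'$
  (\<open>card_pendant_plus_support_le\<close>).

  Second, a vertex of $I \setminus S$ has all its neighbours in $V \setminus (P \cup I)$, and by
  frugality each vertex there is hit at most twice. So the degrees over $I \setminus S$ add up to
  at most $2|V \setminus (P \cup I)|$ (\<open>sum_deg_le\<close>); here pendant vertices have degree $1$
  and the others have degree at least $\delta^*$. The announced inequality is a linear combination
  of these two.

  If every vertex is pendant or a support vertex, the first estimate already bounds $|I|$ by
  $s + s'$, and choosing one pendant neighbour of each weak and two of each strong support vertex
  attains this value. For sharpness of the general bound take disjoint copies of the complete graph
  $K_{d+2}$ minus one edge, where $I$ collects the two ends of each missing edge: for $d \neq 1$ there are no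
  pendant vertices, the minimum degree is $d$, and every other vertex is hit exactly twice.
\<close>

section \<open>Neighbourhoods and degrees\<close>

context pair_graph
begin

lemma finite_neighbors: "finite (neighbors G v)"
  by (rule finite_subset[OF _ pair_finite_verts]) (auto simp: neighbors_def wellformed')

lemma neighbors_subset: "neighbors G v \<subseteq> pverts G"
  by (auto simp: neighbors_def wellformed')

lemma neighbors_sym: "u \<in> neighbors G v \<longleftrightarrow> v \<in> neighbors G u"
  using pair_sym_arcs by (auto simp: neighbors_def symmetric_def dest: symD)

lemma finite_pendant: "finite (pendant_vertices G)"
  using pair_finite_verts by (auto simp: pendant_vertices_def)

lemma finite_support: "finite (support_vertices G)"
  using pair_finite_verts by (auto simp: support_vertices_def)

lemma support_if_adjacent_pendant:
  assumes "u \<in> pendant_vertices G" "u \<in> neighbors G v"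
  shows "v \<in> support_vertices G"
  using assms neighbors_sym neighbors_subset by (auto simp: support_vertices_def)

lemma pendant_neighbors:
  assumes "v \<in> pendant_vertices G"
  obtains w where "neighbors G v = {w}" "w \<in> support_vertices G"
proof -
  from assms obtain w where w: "neighbors G v = {w}"
    by (auto simp: pendant_vertices_def deg_def card_1_singleton_iff)
  then have "v \<in> neighbors G w"
    using neighbors_sym by blast
  then show thesis
    using that w support_if_adjacent_pendant assms by blast
qed

lemma frugal_subset_verts: "frugal_independent_set k G I \<Longrightarrow> I \<subseteq> pverts G"
  by (simp add: frugal_independent_set_def independent_set_def)

lemma frugal_nonadjacent:
  "frugal_independent_set k G I \<Longrightarrow> u \<in> I \<Longrightarrow> v \<in> I \<Longrightarrow> v \<notin> neighbors G u"
  by (auto simp: frugal_independent_set_def independent_set_def neighbors_def)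

lemma frugal_card_le:
  assumes "frugal_independent_set k G I" "v \<in> pverts G" "A \<subseteq> neighbors G v \<inter> I"
  shows "card A \<le> k"
proof -
  have "card A \<le> card (neighbors G v \<inter> I)"
    using assms(3) finite_neighbors by (intro card_mono) auto
  with assms(1,2) show ?thesis
    by (auto simp: frugal_independent_set_def)
qed

lemma finite_frugal_cards: "finite {card I | I. frugal_independent_set k G I}"
proof -
  have "{card I | I. frugal_independent_set k G I} \<subseteq> card ` Pow (pverts G)"
    using frugal_subset_verts by auto
  then show ?thesis
    using finite_subset pair_finite_verts by blast
qed

lemma frugal_independence_number_ge:
  assumes "frugal_independent_set k G I"
  shows "card I \<le> frugal_independence_number k G"
  unfolding frugal_independence_number_def
  using assms by (intro Max_ge finite_frugal_cards) auto

lemma frugal_independence_number_attained: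
  obtains I where "frugal_independent_set k G I" "card I = frugal_independence_number k G"
proof -
  have "frugal_independent_set k G {}"
    by (simp add: frugal_independent_set_def independent_set_def)
  then have "frugal_independence_number k G \<in> {card I | I. frugal_independent_set k G I}"
    unfolding frugal_independence_number_def by (intro Max_in finite_frugal_cards) auto
  with that show thesis by auto
qed

section \<open>Counting incidences\<close>

lemma sum_card_neighbors_swap:
  assumes "finite A" "finite B"
  shows "(\<Sum>w\<in>A. card (neighbors G w \<inter> B)) = (\<Sum>v\<in>B. card (neighbors G v \<inter> A))"
proof -
  have count: "card (neighbors G w \<inter> C) = (\<Sum>v\<in>C. of_bool (v \<in> neighbors G w))"
    if "finite C" for w C
    using that by (simp add: Int_commute)
  have "(\<Sum>w\<in>A. card (neighbors G w \<inter> B)) = (\<Sum>w\<in>A. \<Sum>v\<in>B. of_bool (v \<in> neighbors G w))"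
    using assms by (simp only: count)
  also have "\<dots> = (\<Sum>v\<in>B. \<Sum>w\<in>A. of_bool (w \<in> neighbors G v))"
    by (subst sum.swap) (simp only: neighbors_sym)
  finally show ?thesis
    using assms by (simp only: count)
qed

lemma sum_over_support:
  "(\<Sum>w\<in>support_vertices G. 1 + of_bool (w \<in> strong_support_vertices G))
    = card (support_vertices G) + card (strong_support_vertices G)"
proof -
  have "support_vertices G \<inter> strong_support_vertices G = strong_support_vertices G"
    by (auto simp: strong_support_vertices_def)
  then show ?thesis
    using finite_support by (subst sum.distrib) simp
qed

text \<open>
  Since a pendant vertex has a single neighbour, which is a support vertex, the elements of
  $I \cap P$ are counted once each when every support vertex counts those adjacent to it.
\<close>
lemma card_pendant_plus_support_le:
  assumes "frugal_independent_set 2 G I"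
  shows "card (pendant_vertices G \<inter> I) + card (support_vertices G \<inter> I)
    \<le> card (support_vertices G) + card (strong_support_vertices G)"
proof -
  let ?P = "pendant_vertices G" and ?S = "support_vertices G"
  have "(\<Sum>w\<in>?S. card (neighbors G w \<inter> (?P \<inter> I))) = (\<Sum>v\<in>?P \<inter> I. card (neighbors G v \<inter> ?S))"
    using finite_pendant finite_support by (intro sum_card_neighbors_swap) auto
  also have "\<dots> = (\<Sum>v\<in>?P \<inter> I. 1)"
  proof (rule sum.cong)
    fix v assume "v \<in> ?P \<inter> I"
    then obtain w where "neighbors G v = {w}" "w \<in> ?S"
      using pendant_neighbors by blast
    then show "card (neighbors G v \<inter> ?S) = 1" by simp
  qed simp
  finally have "card (?P \<inter> I) + card (?S \<inter> I)
      = (\<Sum>w\<in>?S. card (neighbors G w \<inter> (?P \<inter> I)) + of_bool (w \<in> I))"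
    using finite_support by (simp add: sum.distrib)
  also have "\<dots> \<le> (\<Sum>w\<in>?S. 1 + of_bool (w \<in> strong_support_vertices G))"
  proof (rule sum_mono)
    fix w assume w: "w \<in> ?S"
    show "card (neighbors G w \<inter> (?P \<inter> I)) + of_bool (w \<in> I)
        \<le> 1 + of_bool (w \<in> strong_support_vertices G)"
    proof (cases "w \<in> I")
      case True
      then have "neighbors G w \<inter> (?P \<inter> I) = {}"
        using frugal_nonadjacent[OF assms] by auto
      then show ?thesis by simp
    next
      case False
      have "card (neighbors G w \<inter> (?P \<inter> I)) \<le> 2"
        using w by (intro frugal_card_le[OF assms]) (auto simp: support_vertices_def)
      moreover have "card (neighbors G w \<inter> (?P \<inter> I)) \<le> card (neighbors G w \<inter> ?P)"
        using finite_neighbors by (intro card_mono) auto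
      ultimately show ?thesis
        using w False by (auto simp: strong_support_vertices_def weak_support_vertices_def)
    qed
  qed
  finally show ?thesis by (simp only: sum_over_support)
qed

text \<open>
  A neighbour of a vertex in $I \setminus S$ is not in $I$ by independence and not in $P$ because
  only support vertices have pendant neighbours.
\<close>
lemma sum_deg_le:
  assumes "frugal_independent_set 2 G I"
  shows "(\<Sum>v\<in>I - support_vertices G. deg G v) \<le> 2 * card (pverts G - pendant_vertices G - I)"
proof -
  let ?W = "pverts G - pendant_vertices G - I" and ?J = "I - support_vertices G"
  have fin: "finite ?W" "finite ?J"
    using pair_finite_verts finite_subset[OF frugal_subset_verts[OF assms]] by auto
  have "neighbors G v \<inter> ?W = neighbors G v" if "v \<in> ?J" for v
    using that frugal_nonadjacent[OF assms] neighbors_subset support_if_adjacent_pendant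
    by blast
  then have "(\<Sum>v\<in>?J. deg G v) = (\<Sum>v\<in>?J. card (neighbors G v \<inter> ?W))"
    by (intro sum.cong) (auto simp: deg_def)
  also have "\<dots> = (\<Sum>w\<in>?W. card (neighbors G w \<inter> ?J))"
    using fin by (intro sum_card_neighbors_swap)
  also have "\<dots> \<le> (\<Sum>w\<in>?W. 2)"
    by (intro sum_mono frugal_card_le[OF assms]) auto
  finally show ?thesis by simp
qed

section \<open>The upper bound\<close>

text \<open>
  The vertices in $I \cap P \cap S$, which lie in components $K_2$, are the reason to keep
  $q_2 = |I \cap P \cap S|$ apart: they occur in both summands of
  \<open>card_pendant_plus_support_le\<close>, and this surplus pays for their contribution to $|I|$.
\<close>
lemma card_frugal_le:
  assumes frugal: "frugal_independent_set 2 G I"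
    and d: "\<And>v. v \<in> pverts G - (pendant_vertices G \<union> support_vertices G) \<Longrightarrow> d \<le> deg G v"
  shows "(d + 2) * card I \<le> 2 * card (pverts G - pendant_vertices G)
    + (card (support_vertices G) + card (strong_support_vertices G)) * (d + 1)"
proof -
  let ?V = "pverts G" and ?P = "pendant_vertices G" and ?S = "support_vertices G"
  have IV: "I \<subseteq> ?V" by (rule frugal_subset_verts[OF frugal])
  have finI: "finite I" using IV pair_finite_verts finite_subset by blast
  define k where "k = card (I - (?P \<union> ?S))"
  define q1 where "q1 = card (I \<inter> ?P - ?S)"
  define q2 where "q2 = card (I \<inter> ?P \<inter> ?S)"
  define i where "i = card (I \<inter> ?S - ?P)"
  have J: "I - ?S = (I - (?P \<union> ?S)) \<union> (I \<inter> ?P - ?S)" by auto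
  have "(\<Sum>v\<in>I - ?S. deg G v)
      = (\<Sum>v\<in>I - (?P \<union> ?S). deg G v) + (\<Sum>v\<in>I \<inter> ?P - ?S. deg G v)"
    unfolding J using finI by (intro sum.union_disjoint) auto
  moreover have "(\<Sum>v\<in>I - (?P \<union> ?S). d) \<le> (\<Sum>v\<in>I - (?P \<union> ?S). deg G v)"
    using IV by (intro sum_mono d) auto
  moreover have "(\<Sum>v\<in>I \<inter> ?P - ?S. deg G v) = (\<Sum>v\<in>I \<inter> ?P - ?S. 1)"
    by (intro sum.cong) (auto simp: pendant_vertices_def)
  ultimately have "d * k + q1 \<le> 2 * card (?V - ?P - I)"
    using sum_deg_le[OF frugal] by (simp add: k_def q1_def mult.commute)
  moreover have "card (?V - ?P) = card (?V - ?P - I) + (k + i)"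
  proof -
    have "card (?V - ?P) = card ((?V - ?P - I) \<union> ((I - (?P \<union> ?S)) \<union> (I \<inter> ?S - ?P)))"
      using IV by (intro arg_cong[where f = card]) auto
    then show ?thesis
      using finI pair_finite_verts unfolding k_def i_def
      by (simp add: card_Un_disjoint Int_Un_distrib disjoint_iff)
  qed
  moreover have "card I = k + q1 + q2 + i"
  proof -
    have "card I = card (((I - (?P \<union> ?S)) \<union> (I \<inter> ?P - ?S)) \<union> ((I \<inter> ?P \<inter> ?S) \<union> (I \<inter> ?S - ?P)))"
      by (intro arg_cong[where f = card]) auto
    also have "\<dots> = card ((I - (?P \<union> ?S)) \<union> (I \<inter> ?P - ?S)) + card ((I \<inter> ?P \<inter> ?S) \<union> (I \<inter> ?S - ?P))"
      using finI by (intro card_Un_disjoint) auto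
    also have "card ((I - (?P \<union> ?S)) \<union> (I \<inter> ?P - ?S)) = k + q1"
      unfolding k_def q1_def using finI by (intro card_Un_disjoint) auto
    also have "card ((I \<inter> ?P \<inter> ?S) \<union> (I \<inter> ?S - ?P)) = q2 + i"
      unfolding q2_def i_def using finI by (intro card_Un_disjoint) auto
    finally show ?thesis by simp
  qed
  moreover have "(q1 + q2 + (q2 + i)) * (d + 1) \<le> (card ?S + card (strong_support_vertices G)) * (d + 1)"
  proof (intro mult_right_mono)
    have "card (?P \<inter> I) = card ((I \<inter> ?P - ?S) \<union> (I \<inter> ?P \<inter> ?S))"
      by (intro arg_cong[where f = card]) auto
    then have "card (?P \<inter> I) = q1 + q2"
      unfolding q1_def q2_def using finI by (subst (asm) card_Un_disjoint) auto
    moreover have "card (?S \<inter> I) = card ((I \<inter> ?P \<inter> ?S) \<union> (I \<inter> ?S - ?P))"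
      by (intro arg_cong[where f = card]) auto
    then have "card (?S \<inter> I) = q2 + i"
      unfolding q2_def i_def using finI by (subst (asm) card_Un_disjoint) auto
    ultimately show "q1 + q2 + (q2 + i) \<le> card ?S + card (strong_support_vertices G)"
      using card_pendant_plus_support_le[OF frugal] by simp
  qed simp
  ultimately show ?thesis
    by (simp add: algebra_simps)
qed

lemma frugal_independence_number_le_frugal_bound:
  assumes "pendant_vertices G \<union> support_vertices G \<subset> pverts G"
  shows "real (frugal_independence_number 2 G) \<le> frugal_bound G"
proof -
  obtain I where I: "frugal_independent_set 2 G I" "card I = frugal_independence_number 2 G"
    by (rule frugal_independence_number_attained)
  have "(delta_star G + 2) * card I \<le> 2 * card (pverts G - pendant_vertices G)
      + (card (support_vertices G) + card (strong_support_vertices G)) * (delta_star G + 1)"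
    using pair_finite_verts by (intro card_frugal_le I) (auto simp: delta_star_def)
  moreover have "real (card (pverts G - pendant_vertices G))
      = real (card (pverts G)) - real (card (pendant_vertices G))"
    using assms by (subst card_Diff_subset[OF finite_pendant])
      (auto intro!: of_nat_diff card_mono pair_finite_verts)
  moreover have "real ((delta_star G + 2) * card I)
      \<le> real (2 * card (pverts G - pendant_vertices G)
      + (card (support_vertices G) + card (strong_support_vertices G)) * (delta_star G + 1))"
    using calculation(1) by (simp only: of_nat_le_iff)
  ultimately show ?thesis
    by (simp add: frugal_bound_def Let_def I(2) pos_le_divide_eq algebra_simps)
qed

section \<open>Graphs consisting of pendant and support vertices\<close>

text \<open>
  Disjointness of $P$ and $S$ makes any set of pendant vertices independent, so only frugality
  restricts how many pendant neighbours of a support vertex may be chosen.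
\<close>
lemma frugal_independence_number_pendant_support:
  assumes V: "pverts G = pendant_vertices G \<union> support_vertices G"
    and disj: "pendant_vertices G \<inter> support_vertices G = {}"
  shows "frugal_independence_number 2 G
    = card (support_vertices G) + card (strong_support_vertices G)"
proof (rule antisym)
  let ?P = "pendant_vertices G" and ?S = "support_vertices G"
  obtain I where I: "frugal_independent_set 2 G I" "card I = frugal_independence_number 2 G"
    by (rule frugal_independence_number_attained)
  have "I = (?P \<inter> I) \<union> (?S \<inter> I)"
    using frugal_subset_verts[OF I(1)] V by auto
  then have "card I \<le> card (?P \<inter> I) + card (?S \<inter> I)"
    by (metis card_Un_le)
  then show "frugal_independence_number 2 G \<le> card ?S + card (strong_support_vertices G)"
    using card_pendant_plus_support_le[OF I(1)] I(2) by simp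
next
  let ?P = "pendant_vertices G" and ?S = "support_vertices G"
  have "\<exists>C\<subseteq>neighbors G w \<inter> ?P. card C = 1 + of_bool (w \<in> strong_support_vertices G)"
    if w: "w \<in> ?S" for w
  proof (rule obtain_subset_with_card_n)
    have "neighbors G w \<inter> ?P \<noteq> {}" "finite (neighbors G w \<inter> ?P)"
      using w finite_neighbors by (auto simp: support_vertices_def)
    then have "card (neighbors G w \<inter> ?P) \<noteq> 0" by simp
    with w show "1 + of_bool (w \<in> strong_support_vertices G) \<le> card (neighbors G w \<inter> ?P)"
      by (auto simp: strong_support_vertices_def weak_support_vertices_def)
  qed blast
  then obtain C where C: "\<And>w. w \<in> ?S \<Longrightarrow> C w \<subseteq> neighbors G w \<inter> ?P"
    and card_C: "\<And>w. w \<in> ?S \<Longrightarrow> card (C w) = 1 + of_bool (w \<in> strong_support_vertices G)"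
    by metis
  define I where "I = (\<Union>w\<in>?S. C w)"
  have IP: "I \<subseteq> ?P" using C by (auto simp: I_def)
  have unique: "w = w'" if "v \<in> C w" "w \<in> ?S" "v \<in> neighbors G w'" for v w w'
  proof -
    have "v \<in> ?P" "w \<in> neighbors G v" "w' \<in> neighbors G v"
      using that C neighbors_sym by blast+
    then show ?thesis by (metis pendant_neighbors singletonD)
  qed
  have "frugal_independent_set 2 G I"
    unfolding frugal_independent_set_def independent_set_def
  proof (intro conjI ballI)
    show "I \<subseteq> pverts G" using IP V by auto
    show "(u, v) \<notin> parcs G" if "u \<in> I" "v \<in> I" for u v
      using that IP disj support_if_adjacent_pendant[of v u] by (auto simp: neighbors_def)
    fix v assume v: "v \<in> pverts G"
    show "card (neighbors G v \<inter> I) \<le> 2"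
    proof (cases "v \<in> ?S")
      case True
      have "neighbors G v \<inter> I \<subseteq> C v"
        using unique by (auto simp: I_def)
      moreover have "finite (C v)"
        using C[OF True] finite_neighbors finite_subset by blast
      ultimately have "card (neighbors G v \<inter> I) \<le> card (C v)"
        by (intro card_mono)
      then show ?thesis using card_C[OF True]
        by (cases "v \<in> strong_support_vertices G") simp_all
    next
      case False
      then have "v \<in> ?P" using v V by blast
      then have "card (neighbors G v) = 1"
        by (simp add: pendant_vertices_def deg_def)
      moreover have "card (neighbors G v \<inter> I) \<le> card (neighbors G v)"
        using finite_neighbors by (intro card_mono) auto
      ultimately show ?thesis by simp
    qed
  qed
  moreover have "card I = (\<Sum>w\<in>?S. card (C w))"
    unfolding I_def
  proof (rule card_UN_disjoint)
    show "\<forall>w\<in>?S. finite (C w)"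
      using C finite_neighbors finite_subset by blast
    show "\<forall>w\<in>?S. \<forall>w'\<in>?S. w \<noteq> w' \<longrightarrow> C w \<inter> C w' = {}"
      using unique C by blast
  qed (rule finite_support)
  then have "card I = card ?S + card (strong_support_vertices G)"
    using card_C by (simp add: sum_over_support[symmetric])
  ultimately show "card ?S + card (strong_support_vertices G) \<le> frugal_independence_number 2 G"
    using frugal_independence_number_ge by metis
qed

end

section \<open>Sharpness\<close>

text \<open>
  The disjoint union of \<open>m\<close> copies of $K_{d+2}$ minus an edge: quotient and remainder modulo
  \<open>d + 2\<close> give the copy and the position in it, and the missing edge joins positions 0 and 1.
  For \<open>d = 0\<close> this is the edgeless graph on \<open>2 * m\<close> vertices.
\<close>
definition punctured_cliques :: "nat \<Rightarrow> nat \<Rightarrow> nat pair_pre_digraph" where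
  "punctured_cliques m d = \<lparr> pverts = {..<m * (d + 2)},
     parcs = {(u, v). u < m * (d + 2) \<and> v < m * (d + 2) \<and> u \<noteq> v
       \<and> u div (d + 2) = v div (d + 2) \<and> (2 \<le> u mod (d + 2) \<or> 2 \<le> v mod (d + 2))} \<rparr>"

lemma pair_graph_punctured_cliques: "pair_graph (punctured_cliques m d)"
proof
  let ?G = "punctured_cliques m d"
  show "finite (pverts ?G)" by (simp add: punctured_cliques_def)
  have "parcs ?G \<subseteq> {..<m * (d + 2)} \<times> {..<m * (d + 2)}"
    by (auto simp: punctured_cliques_def)
  then show "finite (parcs ?G)" by (rule finite_subset) simp
  show "symmetric ?G"
    by (auto simp: symmetric_def sym_def punctured_cliques_def)
qed (auto simp: punctured_cliques_def)

lemma block_subset: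
  fixes q m b :: nat
  assumes "q < m"
  shows "{q * b..<q * b + b} \<subseteq> {..<m * b}"
proof -
  have "q * b + b \<le> m * b"
    using mult_le_mono1[of "Suc q" m b] assms by simp
  then show ?thesis by auto
qed

lemma div_eq_iff_block:
  fixes q v b :: nat
  assumes "0 < b"
  shows "v div b = q \<longleftrightarrow> v \<in> {q * b..<q * b + b}"
proof
  assume "v div b = q"
  then show "v \<in> {q * b..<q * b + b}"
    using div_mult_mod_eq[of v b] mod_less_divisor[OF assms, of v] by auto
next
  assume "v \<in> {q * b..<q * b + b}"
  then show "v div b = q"
    by (intro div_nat_eqI) (auto simp: mult.commute)
qed

lemma neighbors_punctured_cliques:
  assumes "v < m * (d + 2)"
  shows "neighbors (punctured_cliques m d) v =
    (if v mod (d + 2) < 2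
     then {v div (d + 2) * (d + 2) + 2..<v div (d + 2) * (d + 2) + (d + 2)}
     else {v div (d + 2) * (d + 2)..<v div (d + 2) * (d + 2) + (d + 2)} - {v})"
proof -
  define b q where "b = d + 2" and "q = v div b"
  have b: "0 < b" by (simp add: b_def)
  have q: "q < m" using assms by (simp add: q_def b_def less_mult_imp_div_less)
  have mod: "u mod b = u - q * b" if "u \<in> {q * b..<q * b + b}" for u
    using that div_eq_iff_block[OF b, of u q] by (simp add: minus_div_mult_eq_mod[symmetric])
  have "u \<in> neighbors (punctured_cliques m d) v \<longleftrightarrow>
      u \<in> {q * b..<q * b + b} \<and> u \<noteq> v \<and> (2 \<le> v mod b \<or> 2 \<le> u - q * b)" for u
  proof -
    have "u \<in> neighbors (punctured_cliques m d) v \<longleftrightarrow>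
        u < m * b \<and> u \<noteq> v \<and> u div b = q \<and> (2 \<le> v mod b \<or> 2 \<le> u mod b)"
      using assms unfolding neighbors_def punctured_cliques_def b_def q_def by auto
    then show ?thesis
      using block_subset[OF q, of b] mod[of u] div_eq_iff_block[OF b, of u q]
      by (metis lessThan_iff subsetD)
  qed
  moreover have "v mod b = v - q * b" "v \<in> {q * b..<q * b + b}"
    using mod[of v] div_eq_iff_block[OF b, of v q] by (simp_all add: q_def)
  moreover define x where "x = q * b"
  ultimately have "u \<in> neighbors (punctured_cliques m d) v \<longleftrightarrow>
      u \<in> (if v mod b < 2 then {x + 2..<x + b} else {x..<x + b} - {v})" for u
    by (cases "v mod b < 2") (simp; linarith)+
  then show ?thesis
    unfolding b_def[symmetric] q_def[symmetric] x_def[symmetric] by (intro set_eqI)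
qed

lemma deg_punctured_cliques:
  assumes "v < m * (d + 2)"
  shows "deg (punctured_cliques m d) v = (if v mod (d + 2) < 2 then d else d + 1)"
proof -
  have "v \<in> {v div (d + 2) * (d + 2)..<v div (d + 2) * (d + 2) + (d + 2)}"
    using div_eq_iff_block[of "d + 2" v "v div (d + 2)"] by simp
  then show ?thesis
    by (auto simp: deg_def neighbors_punctured_cliques[OF assms])
qed

text \<open>
  For \<open>d = 1\<close> each copy is a path on three vertices, whose ends are pendant. Otherwise the degrees
  \<open>d\<close> and \<open>d + 1\<close> of the graph, of which the latter requires \<open>d > 0\<close>, differ from 1.
\<close>
lemma pendant_punctured_cliques:
  assumes "d \<noteq> 1"
  shows "pendant_vertices (punctured_cliques m d) = {}"
    and "support_vertices (punctured_cliques m d) = {}"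
    and "strong_support_vertices (punctured_cliques m d) = {}"
proof -
  have "v mod 2 < 2" for v :: nat by simp
  then have "deg (punctured_cliques m d) v \<noteq> 1" if "v < m * (d + 2)" for v
    using assms deg_punctured_cliques[OF that]
    by (cases "d = 0") (auto simp del: add_2_eq_Suc')
  then show "pendant_vertices (punctured_cliques m d) = {}"
    by (auto simp: pendant_vertices_def punctured_cliques_def)
  then show "support_vertices (punctured_cliques m d) = {}"
    by (simp add: support_vertices_def)
  then show "strong_support_vertices (punctured_cliques m d) = {}"
    by (simp add: strong_support_vertices_def)
qed

lemma delta_star_punctured_cliques:
  assumes "d \<noteq> 1" "0 < m"
  shows "delta_star (punctured_cliques m d) = d"
proof -
  let ?G = "punctured_cliques m d"
  have V: "pverts ?G - (pendant_vertices ?G \<union> support_vertices ?G) = {..<m * (d + 2)}"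
    by (simp add: pendant_punctured_cliques[OF assms(1)]) (simp add: punctured_cliques_def)
  have "deg ?G 0 = d" using assms(2) by (simp add: deg_punctured_cliques)
  then have "d \<in> deg ?G ` {..<m * (d + 2)}"
    using assms(2) by (intro image_eqI[of _ _ 0]) auto
  moreover have "d \<le> deg ?G v" if "v < m * (d + 2)" for v
    by (simp add: deg_punctured_cliques[OF that])
  ultimately show ?thesis
    unfolding delta_star_def V by (intro Min_eqI) auto
qed

lemma frugal_bound_punctured_cliques:
  assumes "d \<noteq> 1" "0 < m"
  shows "frugal_bound (punctured_cliques m d) = 2 * real m"
proof -
  have "card (pverts (punctured_cliques m d)) = m * (d + 2)"
    by (simp add: punctured_cliques_def)
  then have "frugal_bound (punctured_cliques m d) = 2 * (real m * (real d + 2)) / (real d + 2)"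
    by (simp add: frugal_bound_def pendant_punctured_cliques[OF assms(1)]
        delta_star_punctured_cliques[OF assms] del: add_2_eq_Suc')
  then show ?thesis by simp
qed

lemma frugal_independence_number_punctured_cliques_ge:
  "2 * m \<le> frugal_independence_number 2 (punctured_cliques m d)"
proof -
  interpret pair_graph "punctured_cliques m d" by (rule pair_graph_punctured_cliques)
  let ?b = "d + 2"
  define I where "I = {v. v < m * ?b \<and> v mod ?b < 2}"
  have "frugal_independent_set 2 (punctured_cliques m d) I"
    unfolding frugal_independent_set_def independent_set_def
  proof (intro conjI ballI)
    show "I \<subseteq> pverts (punctured_cliques m d)"
      by (auto simp: I_def punctured_cliques_def)
    show "(u, v) \<notin> parcs (punctured_cliques m d)" if "u \<in> I" "v \<in> I" for u v
      using that by (auto simp: I_def punctured_cliques_def)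
    fix v
    let ?N = "neighbors (punctured_cliques m d) v \<inter> I"
    define x where "x = v div ?b * ?b"
    have "u = x \<or> u = x + 1" if "u \<in> ?N" for u
    proof -
      have "u div ?b = v div ?b" "u mod ?b < 2"
        using that by (auto simp: neighbors_def I_def punctured_cliques_def)
      then have "x + u mod ?b = u"
        using div_mult_mod_eq[of u ?b] by (simp only: x_def)
      with \<open>u mod ?b < 2\<close> show ?thesis by linarith
    qed
    then have "?N \<subseteq> {x, x + 1}" by blast
    then have "card ?N \<le> card {x, x + 1}"
      by (intro card_mono) auto
    then show "card ?N \<le> 2" by simp
  qed
  then have "card I \<le> frugal_independence_number 2 (punctured_cliques m d)"
    by (rule frugal_independence_number_ge)
  moreover have "card ({..<m} \<times> {..<2::nat}) \<le> card I"
  proof (rule card_inj_on_le)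
    show "inj_on (\<lambda>(q, r). q * ?b + r) ({..<m} \<times> {..<2::nat})"
    proof (rule inj_on_inverseI)
      fix x assume "x \<in> {..<m} \<times> {..<2::nat}"
      then show "(\<lambda>v. (v div ?b, v mod ?b)) ((\<lambda>(q, r). q * ?b + r) x) = x"
        by (auto simp del: add_2_eq_Suc')
    qed
    have "q * ?b + r < m * ?b" if "q < m" "r < 2" for q r
      using block_subset[OF that(1), of ?b] that(2) by (auto simp: subset_iff)
    then show "(\<lambda>(q, r). q * ?b + r) ` ({..<m} \<times> {..<2::nat}) \<subseteq> I"
      by (auto simp: I_def simp del: add_2_eq_Suc')
    show "finite I"
      by (rule finite_subset[of _ "{..<m * ?b}"]) (auto simp: I_def)
  qed
  ultimately show ?thesis by simp
qed

lemma frugal_bound_sharp: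
  assumes "d \<noteq> 1"
  shows "\<exists>H :: nat pair_pre_digraph.
    pair_graph H \<and> card (pverts H) \<ge> 2 \<and> card (pverts H) \<ge> N
    \<and> pendant_vertices H \<union> support_vertices H \<subset> pverts H
    \<and> delta_star H = d
    \<and> real (frugal_independence_number 2 H) = frugal_bound H"
proof -
  let ?H = "punctured_cliques (N + 1) d"
  interpret pair_graph ?H by (rule pair_graph_punctured_cliques)
  have card: "card (pverts ?H) = (N + 1) * (d + 2)"
    by (simp add: punctured_cliques_def)
  have "2 \<le> card (pverts ?H)" "N \<le> card (pverts ?H)"
    unfolding card by (simp_all add: algebra_simps)
  moreover from this(1) have ps: "pendant_vertices ?H \<union> support_vertices ?H \<subset> pverts ?H"
    by (auto simp: pendant_punctured_cliques[OF assms])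
  moreover have "real (frugal_independence_number 2 ?H) = frugal_bound ?H"
    using frugal_independence_number_le_frugal_bound[OF ps]
      frugal_independence_number_punctured_cliques_ge[of "N + 1" d]
    by (simp add: frugal_bound_punctured_cliques[OF assms])
  ultimately show ?thesis
    using pair_graph_axioms delta_star_punctured_cliques[OF assms, of "N + 1"]
    by (intro exI[of _ ?H]) simp
qed

(* The hypothesis P(G) \<inter> S(G) = {} of the first claim says that no component of G is K2.
   It cannot be dropped: for G = K2 both vertices are pendant and weak support vertices, so
   s + s' = 2, whereas the 2-frugal independence number is 1.

   In the last claim d = 1 is excluded because a vertex of degree 1 is pendant, so delta_star
   never takes the value 1. *)
theorem theorem3p2:
  fixes G :: "'a pair_pre_digraph"
  assumes "pair_graph G"
    and "card (pverts G) \<ge> 2"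
  shows "(pverts G = pendant_vertices G \<union> support_vertices G
           \<and> pendant_vertices G \<inter> support_vertices G = {}
           \<longrightarrow> frugal_independence_number 2 G
               = card (support_vertices G) + card (strong_support_vertices G))
       \<and> (pendant_vertices G \<union> support_vertices G \<subset> pverts G
           \<longrightarrow> real (frugal_independence_number 2 G) \<le> frugal_bound G)
       \<and> (\<forall>d N. d \<noteq> 1 \<longrightarrow>
           (\<exists>H :: nat pair_pre_digraph.
              pair_graph H \<and> card (pverts H) \<ge> 2 \<and> card (pverts H) \<ge> N
              \<and> pendant_vertices H \<union> support_vertices H \<subset> pverts H
              \<and> delta_star H = d
              \<and> real (frugal_independence_number 2 H) = frugal_bound H))"
proof (intro conjI impI allI)
  interpret pair_graph G by (rule assms(1))
  show "frugal_independence_number 2 G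
      = card (support_vertices G) + card (strong_support_vertices G)"
    if "pverts G = pendant_vertices G \<union> support_vertices G
      \<and> pendant_vertices G \<inter> support_vertices G = {}"
    using that frugal_independence_number_pendant_support by blast
  show "real (frugal_independence_number 2 G) \<le> frugal_bound G"
    if "pendant_vertices G \<union> support_vertices G \<subset> pverts G"
    using that by (rule frugal_independence_number_le_frugal_bound)
qed (rule frugal_bound_sharp)

end
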